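(* Let $G$ be a finite simple graph on $n$ vertices with maximum vertex degree $\Delta(G)$. Then $m_G[1,n] \geq \Delta(G)$.
   Context: For a finite simple undirected graph $G$ on $n$ vertices, its Laplacian matrix is $L_G = D - A$, where $A$ is the adjacency matrix and $D$ is the diagonal matrix of vertex degrees; its eigenvalues lie in $[0,n]$. For a real interval $I$, $m_G(I)$ denotes the number of Laplacian eigenvalues of $G$, counted with multiplicity, lying in $I$. *)

theory Defs
  imports "Graph_Theory.Digraph" "Jordan_Normal_Form.Char_Poly"
begin

text \<open>
  A finite simple undirected graph is a \<open>graph\<close> of \<open>Graph_Theory\<close>: a finite digraph without loops
  and multiple arcs whose arc relation is symmetric. Every undirected edge is thus a pair of opposite
  arcs, and the degree of a vertex is its \<open>out_degree\<close>.
\<close>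

text \<open>The added 0 only matters for the graph without vertices, whose maximum degree is thereby 0.\<close>

definition max_degree :: "('a, 'b) pre_digraph \<Rightarrow> nat" where
  "max_degree G = Max (insert 0 (out_degree G ` verts G))"

text \<open>
  Matrices are indexed by \<open>{0..<n}\<close>, so they are taken with respect to a list \<open>vs\<close> that enumerates
  the vertices, each exactly once. Another enumeration conjugates them by a permutation matrix, which
  does not change the spectrum.
\<close>

definition adjacency_mat :: "('a, 'b) pre_digraph \<Rightarrow> 'a list \<Rightarrow> real mat" where
  "adjacency_mat G vs =
     mat (length vs) (length vs) (\<lambda>(i, j). if vs ! i \<rightarrow>\<^bsub>G\<^esub> vs ! j then 1 else 0)"

definition degree_mat :: "('a, 'b) pre_digraph \<Rightarrow> 'a list \<Rightarrow> real mat" where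
  "degree_mat G vs =
     mat (length vs) (length vs) (\<lambda>(i, j). if i = j then real (out_degree G (vs ! i)) else 0)"

definition laplacian_mat :: "('a, 'b) pre_digraph \<Rightarrow> 'a list \<Rightarrow> real mat" where
  "laplacian_mat G vs = degree_mat G vs - adjacency_mat G vs"

text \<open>
  The multiset of roots of the characteristic polynomial contains every real eigenvalue with its
  algebraic multiplicity. As a real symmetric matrix, the Laplacian has no other eigenvalues.
\<close>

definition laplacian_eigenvalue_count :: "('a, 'b) pre_digraph \<Rightarrow> 'a list \<Rightarrow> real set \<Rightarrow> nat" where
  "laplacian_eigenvalue_count G vs I =
     size {# x \<in># proots (char_poly (laplacian_mat G vs)). x \<in> I #}"

end

theory Submission
  imports Defs "Jordan_Normal_Form.Spectral_Radius"
begin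

text \<open>
  The quadratic form of the Laplacian is \<open>\<Sum>\<^bsub>ij \<in> E\<^esub> (x\<^sub>i - x\<^sub>j)\<^sup>2\<close>. Keep only the edges of the star at a
  vertex \<open>v\<close> of maximum degree \<open>\<Delta>\<close>. On the vectors supported on this star whose entries sum to 0, a
  space of dimension \<open>\<Delta>\<close>, the form of the star is \<open>(\<Delta> + 2) x\<^sub>v\<^sup>2 + \<Sum>\<^bsub>leaves\<^esub> x\<^sub>j\<^sup>2\<close>, hence at least \<open>x \<bullet> x\<close>.
  By the Courant-Fischer principle, at least \<open>\<Delta>\<close> eigenvalues are at least 1. Comparison with the
  complete graph shows that no eigenvalue exceeds \<open>n\<close>.
\<close>

section \<open>Spectral theorem for real symmetric matrices\<close>

lemma real_scalar_prod_self:
  "(x :: real vec) \<bullet> x = (\<Sum>i<dim_vec x. (x $ i)\<^sup>2)"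
  by (simp add: scalar_prod_def power2_eq_square atLeast0LessThan)

lemma real_scalar_prod_self_pos:
  assumes "(x :: real vec) \<in> carrier_vec n" "x \<noteq> 0\<^sub>v n"
  shows "x \<bullet> x > 0"
proof -
  obtain i where "i < n" "x $ i \<noteq> 0"
    using assms by (metis carrier_vecD eq_vecI index_zero_vec)
  then show ?thesis
    using assms unfolding real_scalar_prod_self by (intro sum_pos2[of _ i]) auto
qed

text \<open>Over the complex numbers an eigenvector \<open>z\<close> with eigenvalue
  \<open>l\<close> always exists. Symmetry of \<open>A\<close>, applied to the real and imaginary
  parts \<open>a\<close> and \<open>b\<close> of \<open>z\<close>, forces \<open>Im l = 0\<close>.
  Then whichever of \<open>a\<close> and \<open>b\<close> is nonzero is a real eigenvector, and
  normalising it gives \<open>v\<close>.\<close>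

lemma real_symmetric_eigenvector:
  fixes A :: "real mat"
  assumes A: "A \<in> carrier_mat n n" and sym: "A\<^sup>T = A" and n: "n > 0"
  obtains v c where "v \<in> carrier_vec n" "v \<bullet> v = 1" "A *\<^sub>v v = c \<cdot>\<^sub>v v"
proof -
  define C where "C = map_mat complex_of_real A"
  have C: "C \<in> carrier_mat n n" using A by (simp add: C_def)
  obtain l where "eigenvalue C l"
    using spectrum_non_empty[OF C n] by (auto simp: spectrum_def)
  then obtain z where z: "z \<in> carrier_vec n" "z \<noteq> 0\<^sub>v n" "C *\<^sub>v z = l \<cdot>\<^sub>v z"
    using C unfolding eigenvalue_def eigenvector_def by auto
  define a b where "a = map_vec Re z" and "b = map_vec Im z"
  have ab: "a \<in> carrier_vec n" "b \<in> carrier_vec n" using z by (auto simp: a_def b_def)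
  have Cz: "(\<Sum>j = 0..<n. complex_of_real (A $$ (i, j)) * z $ j) = l * z $ i" if "i < n" for i
    using arg_cong[OF z(3), of "\<lambda>v. v $ i"] that A z(1)
    by (simp add: C_def scalar_prod_def)
  have Aa: "A *\<^sub>v a = Re l \<cdot>\<^sub>v a - Im l \<cdot>\<^sub>v b"
    using A ab z(1) arg_cong[OF Cz, of _ Re]
    by (intro eq_vecI) (auto simp: scalar_prod_def a_def b_def)
  have Ab: "A *\<^sub>v b = Im l \<cdot>\<^sub>v a + Re l \<cdot>\<^sub>v b"
    using A ab z(1) arg_cong[OF Cz, of _ Im]
    by (intro eq_vecI) (auto simp: scalar_prod_def a_def b_def)
  have "(A *\<^sub>v a) \<bullet> b = a \<bullet> (A *\<^sub>v b)"
    using transpose_vec_mult_scalar[OF A ab(2,1)] sym by simp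
  then have "Im l * (a \<bullet> a + b \<bullet> b) = 0"
    unfolding Aa Ab using ab
    by (simp add: minus_scalar_prod_distrib scalar_prod_add_distrib algebra_simps)
  moreover have "a \<noteq> 0\<^sub>v n \<or> b \<noteq> 0\<^sub>v n"
  proof (rule ccontr)
    assume "\<not> ?thesis"
    then have "z $ i = 0" if "i < n" for i
      using that z(1) unfolding a_def b_def
      by (metis carrier_vecD complex_eqI index_map_vec(1) index_zero_vec(1) zero_complex.sel)
    then show False using z by (metis carrier_vecD eq_vecI index_zero_vec)
  qed
  moreover have "a \<bullet> a \<ge> 0" "b \<bullet> b \<ge> 0" unfolding real_scalar_prod_self by (simp_all add: sum_nonneg)
  ultimately have "Im l = 0"
    using real_scalar_prod_self_pos[OF ab(1)] real_scalar_prod_self_pos[OF ab(2)] by fastforce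
  then have "A *\<^sub>v a = Re l \<cdot>\<^sub>v a" "A *\<^sub>v b = Re l \<cdot>\<^sub>v b"
    using Aa Ab ab by (auto simp: algebra_simps)
  then obtain w where w: "w \<in> carrier_vec n" "w \<noteq> 0\<^sub>v n" "A *\<^sub>v w = Re l \<cdot>\<^sub>v w"
    using ab \<open>a \<noteq> 0\<^sub>v n \<or> b \<noteq> 0\<^sub>v n\<close> by metis
  define v where "v = (1 / sqrt (w \<bullet> w)) \<cdot>\<^sub>v w"
  have pos: "w \<bullet> w > 0" using w real_scalar_prod_self_pos by blast
  show thesis
  proof
    show "v \<in> carrier_vec n" using w by (simp add: v_def)
    show "v \<bullet> v = 1" using w pos by (simp add: v_def)
    show "A *\<^sub>v v = Re l \<cdot>\<^sub>v v"
      using w A by (simp add: v_def mult_mat_vec smult_smult_assoc mult.commute)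
  qed
qed

text \<open>The Householder reflection along \<open>v - e\<^sub>0\<close>. If \<open>v = e\<^sub>0\<close>, division by zero makes it the
  identity, as desired.\<close>

lemma householder:
  fixes v :: "real vec"
  assumes v: "v \<in> carrier_vec n" "v \<bullet> v = 1" and n: "n > 0"
  obtains H where "H \<in> carrier_mat n n" "H\<^sup>T = H" "H * H = 1\<^sub>m n" "col H 0 = v"
proof -
  define w where "w = v - unit_vec n 0"
  define s where "s = w \<bullet> w"
  define H where "H = mat n n (\<lambda>(i, j). (if i = j then 1 else 0) - 2 * w $ i * w $ j / s)"
  have w: "w \<in> carrier_vec n" using v by (simp add: w_def)
  have s: "s = (\<Sum>k = 0..<n. w $ k * w $ k)" using w by (simp add: s_def scalar_prod_def)
  have H: "H \<in> carrier_mat n n" by (simp add: H_def)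
  have "(H * H) $$ (i, j) = 1\<^sub>m n $$ (i, j)" if ij: "i < n" "j < n" for i j
  proof -
    have "(H * H) $$ (i, j) = (\<Sum>k = 0..<n. ((if i = k then 1 else 0) - 2 * w $ i * w $ k / s) *
        ((if k = j then 1 else 0) - 2 * w $ k * w $ j / s))"
      using ij by (simp add: H_def scalar_prod_def)
    \<comment> \<open>The Kronecker deltas isolate single summands, and the product of the two
      rank-one terms leaves the factor \<open>w $ k * w $ k\<close>, whose sum is
      \<open>s\<close>.\<close>
    also have "\<dots> = (\<Sum>k = 0..<n. (if k = i then (if i = j then 1 else 0) - 2 * w $ i * w $ j / s else 0)
        - (if k = j then 2 * w $ i * w $ j / s else 0)
        + 4 * w $ i * w $ j / s\<^sup>2 * (w $ k * w $ k))"
      by (intro sum.cong) (auto simp: algebra_simps power2_eq_square)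
    also have "\<dots> = (if i = j then 1 else 0) - 4 * w $ i * w $ j / s + 4 * w $ i * w $ j / s\<^sup>2 * s"
      using ij by (simp add: sum.distrib sum_subtractf s sum_distrib_left sum_divide_distrib)
    \<comment> \<open>If \<open>s = 0\<close>, both corrections are 0 because division by zero
      yields 0; otherwise they cancel.\<close>
    also have "\<dots> = 1\<^sub>m n $$ (i, j)" using ij by (cases "s = 0") (auto simp: power2_eq_square)
    finally show ?thesis .
  qed
  then have HH: "H * H = 1\<^sub>m n" using H by (intro eq_matI) auto
  \<comment> \<open>As \<open>v\<close> is a unit vector, \<open>s = 2 - 2 * v $ 0\<close>. This is
    what makes column 0 of \<open>H\<close> equal to \<open>e\<^sub>0 + w = v\<close>.\<close>
  have s0: "s = - 2 * w $ 0"
  proof -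
    have "s = v \<bullet> v - v \<bullet> unit_vec n 0 - unit_vec n 0 \<bullet> v + unit_vec n 0 \<bullet> unit_vec n 0"
      using v n by (simp add: s_def w_def minus_scalar_prod_distrib scalar_prod_minus_distrib)
    then show ?thesis using v n by (simp add: w_def)
  qed
  have "H $$ (i, 0) = v $ i" if i: "i < n" for i
  proof (cases "s = 0")
    case True
    then have "w = 0\<^sub>v n" using real_scalar_prod_self_pos[OF w] by (auto simp: s_def)
    then have "w $ i = 0" using i by simp
    then have "v $ i = (if i = 0 then 1 else 0)" using v i n by (simp add: w_def)
    then show ?thesis using True i n by (simp add: H_def)
  next
    case False
    then have "w $ 0 \<noteq> 0" using s0 by simp
    then have "2 * w $ i * w $ 0 / s = - w $ i" unfolding s0 by simp
    then show ?thesis using i n v by (simp add: H_def w_def)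
  qed
  then have "col H 0 = v" using H v n by (intro eq_vecI) auto
  moreover have "H\<^sup>T = H" by (intro eq_matI) (auto simp: H_def)
  ultimately show thesis using H HH that by blast
qed

text \<open>Deflation: conjugation by a reflection \<open>H\<close> whose first column is a unit
  eigenvector clears the first column of \<open>B\<close> off the corner, and by symmetry the first
  row too. The induction hypothesis diagonalizes the remaining block \<open>B'\<close>.\<close>

lemma real_symmetric_diagonalization:
  fixes A :: "real mat"
  assumes "A \<in> carrier_mat n n" "A\<^sup>T = A"
  shows "\<exists>P D. P \<in> carrier_mat n n \<and> D \<in> carrier_mat n n \<and> diagonal_mat D \<and> P * P\<^sup>T = 1\<^sub>m n
    \<and> A = P * D * P\<^sup>T"
  using assms
proof (induction n arbitrary: A)
  case 0
  then show ?case by (intro exI[of _ A]) (auto simp: diagonal_mat_def intro!: eq_matI)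
next
  case (Suc n)
  note A = Suc.prems(1)
  obtain v c where v: "v \<in> carrier_vec (Suc n)" "v \<bullet> v = 1" "A *\<^sub>v v = c \<cdot>\<^sub>v v"
    using real_symmetric_eigenvector[OF Suc.prems] by auto
  obtain H where H: "H \<in> carrier_mat (Suc n) (Suc n)" "H\<^sup>T = H" "H * H = 1\<^sub>m (Suc n)" "col H 0 = v"
    using householder[OF v(1,2)] by auto
  define B where "B = H * (A * H)"
  have B: "B \<in> carrier_mat (Suc n) (Suc n)" using A H by (simp add: B_def)
  have symB: "B\<^sup>T = B"
    using A H Suc.prems(2) transpose_mult[OF H(1), of "A * H" "Suc n"] transpose_mult[OF A H(1)]
    by (simp add: B_def assoc_mult_mat[of _ "Suc n" "Suc n" _ "Suc n" _ "Suc n"])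
  \<comment> \<open>\<open>H\<close> sends the first unit vector to its column \<open>v\<close>;
    being an involution, it sends \<open>v\<close> back.\<close>
  have Hv: "H *\<^sub>v v = unit_vec (Suc n) 0"
    using col_mult2[OF H(1,1), of 0] H by simp
  have "col B 0 = H *\<^sub>v (A *\<^sub>v v)"
    unfolding B_def using A H(1,4) col_mult2[OF H(1), of "A * H" "Suc n" 0] col_mult2[OF A H(1), of 0]
    by simp
  also have "\<dots> = c \<cdot>\<^sub>v unit_vec (Suc n) 0"
    using H v by (simp add: mult_mat_vec Hv)
  finally have colB: "col B 0 = c \<cdot>\<^sub>v unit_vec (Suc n) 0" .
  have B0: "B $$ (i, 0) = (if i = 0 then c else 0)" if "i < Suc n" for i
    using that B arg_cong[OF colB, of "\<lambda>v. v $ i"] by simp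
  have B0': "B $$ (0, i) = (if i = 0 then c else 0)" if "i < Suc n" for i
    using that B B0[OF that] symB by (metis carrier_matD index_transpose_mat(1) zero_less_Suc)
  define B' where "B' = mat n n (\<lambda>(i, j). B $$ (Suc i, Suc j))"
  have B': "B' \<in> carrier_mat n n" by (simp add: B'_def)
  have "B $$ (i, j) = B $$ (j, i)" if "i < Suc n" "j < Suc n" for i j
    using that B symB by (metis carrier_matD index_transpose_mat(1))
  then have "B'\<^sup>T = B'" by (intro eq_matI) (auto simp: B'_def)
  then obtain P' D' where PD': "P' \<in> carrier_mat n n" "D' \<in> carrier_mat n n" "diagonal_mat D'"
      "P' * P'\<^sup>T = 1\<^sub>m n" "B' = P' * D' * P'\<^sup>T"
    using Suc.IH[OF B'] by blast
  define C where "C = mat 1 1 (\<lambda>_. c)"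
  define Q where "Q = four_block_mat (1\<^sub>m 1) (0\<^sub>m 1 n) (0\<^sub>m n 1) P'"
  define D where "D = four_block_mat C (0\<^sub>m 1 n) (0\<^sub>m n 1) D'"
  have C: "C \<in> carrier_mat 1 1" by (simp add: C_def)
  have Q: "Q \<in> carrier_mat (Suc n) (Suc n)"
    using four_block_carrier_mat[of "1\<^sub>m 1" 1 1 P' n n] PD' by (simp add: Q_def)
  have D: "D \<in> carrier_mat (Suc n) (Suc n)"
    using four_block_carrier_mat[OF C, of D' n n] PD' by (simp add: D_def)
  have QT: "Q\<^sup>T = four_block_mat (1\<^sub>m 1) (0\<^sub>m 1 n) (0\<^sub>m n 1) P'\<^sup>T"
    unfolding Q_def using PD' by (subst transpose_four_block_mat[of _ 1 1 _ n _ n]) auto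
  have QQ: "Q * Q\<^sup>T = 1\<^sub>m (Suc n)"
    unfolding QT unfolding Q_def using PD'
    by (subst mult_four_block_mat[of _ 1 1 _ n _ n _ _ 1 _ n]) auto
  have "B = four_block_mat C (0\<^sub>m 1 n) (0\<^sub>m n 1) B'"
  proof (rule eq_matI)
    fix i j
    assume "i < dim_row (four_block_mat C (0\<^sub>m 1 n) (0\<^sub>m n 1) B')"
      "j < dim_col (four_block_mat C (0\<^sub>m 1 n) (0\<^sub>m n 1) B')"
    then show "B $$ (i, j) = four_block_mat C (0\<^sub>m 1 n) (0\<^sub>m n 1) B' $$ (i, j)"
      using B0 B0' by (cases i; cases j) (auto simp: C_def B'_def)
  qed (use B in \<open>auto simp: C_def B'_def\<close>)
  also have "\<dots> = Q * D * Q\<^sup>T"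
    unfolding QT unfolding Q_def D_def using PD' C
    by (simp add: mult_four_block_mat[of _ 1 1 _ n _ n _ _ 1 _ n])
  finally have BQ: "B = Q * D * Q\<^sup>T" .
  note assoc = assoc_mult_mat[of _ "Suc n" "Suc n" _ "Suc n" _ "Suc n"]
  have "H * B * H = (H * H) * A * (H * H)" using A H(1) by (simp add: B_def assoc)
  then have "A = H * (Q * D * Q\<^sup>T) * H" using A H BQ by simp
  also have "\<dots> = (H * Q) * D * (H * Q)\<^sup>T"
    using H Q D transpose_mult[OF H(1) Q] by (simp add: assoc)
  finally have AHQ: "A = (H * Q) * D * (H * Q)\<^sup>T" .
  have "(H * Q) * (H * Q)\<^sup>T = H * (Q * Q\<^sup>T) * H"
    using H(1,2) Q transpose_mult[OF H(1) Q] by (simp add: assoc)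
  also have "\<dots> = 1\<^sub>m (Suc n)" unfolding QQ using H by simp
  finally have "(H * Q) * (H * Q)\<^sup>T = 1\<^sub>m (Suc n)" .
  moreover have "diagonal_mat D"
    using PD'(2,3) unfolding diagonal_mat_def D_def C_def by auto
  ultimately show ?case using AHQ H(1) Q D by (intro exI[of _ "H * Q"] exI[of _ D]) simp
qed


section \<open>Bounding eigenvalues by quadratic forms\<close>

text \<open>A homogeneous system with fewer equations than unknowns has a nontrivial solution:
  padded with zero rows to a square matrix, it has determinant 0.\<close>

lemma exists_orthogonal_vec:
  fixes rs :: "'a :: field vec list"
  assumes rs: "set rs \<subseteq> carrier_vec n" and len: "length rs < n"
  obtains x where "x \<in> carrier_vec n" "x \<noteq> 0\<^sub>v n" "\<And>r. r \<in> set rs \<Longrightarrow> r \<bullet> x = 0"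
proof -
  define c where "c i = (if i < length rs then rs ! i else 0\<^sub>v n)" for i
  \<comment> \<open>\<open>c\<close> is already zero at index \<open>length rs\<close>; the explicit
    case distinction gives \<open>M\<close> the shape of \<open>det_row_0\<close>.\<close>
  define M where "M = mat\<^sub>r n n (\<lambda>i. if i = length rs then 0\<^sub>v n else c i)"
  have c: "c \<in> {0..<n} \<rightarrow> carrier_vec n" using rs nth_mem[of _ rs] by (fastforce simp: c_def)
  have M: "M \<in> carrier_mat n n" by (simp add: M_def)
  have "det M = 0" unfolding M_def using len c by (rule det_row_0)
  then obtain x where x: "x \<in> carrier_vec n" "x \<noteq> 0\<^sub>v n" "M *\<^sub>v x = 0\<^sub>v n"
    using det_0_iff_vec_prod_zero_field[OF M] by blast
  have "r \<bullet> x = 0" if r: "r \<in> set rs" for r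
  proof -
    obtain i where i: "i < length rs" "r = rs ! i" using r by (auto simp: in_set_conv_nth)
    have "r \<in> carrier_vec n" using r rs by auto
    then have "row M i = r"
      using i len by (simp add: M_def c_def)
    then show ?thesis using arg_cong[OF x(3), of "\<lambda>v. v $ i"] i len M by simp
  qed
  then show thesis using that x by blast
qed

lemma proots_prod_linear:
  "proots (\<Prod>a\<leftarrow>as. [:- a, 1:]) = mset (as :: 'a :: idom list)"
proof (induction as)
  case (Cons a as)
  have "(\<Prod>a\<leftarrow>as. [:- a, 1:]) \<noteq> (0 :: 'a poly)" by (auto simp: prod_list_zero_iff)
  then show ?case using Cons by (simp add: proots_mult del: mult_pCons_left)
qed auto

text \<open>
  The lower half of Courant-Fischer, with a subspace of codimension at most \<open>length us\<close> given as the
  orthogonal complement of \<open>us\<close>.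
\<close>

lemma count_eigenvalues_ge:
  fixes A :: "real mat"
  assumes A: "A \<in> carrier_mat n n" "A\<^sup>T = A"
    and us: "set us \<subseteq> carrier_vec n"
    and form: "\<And>x. \<lbrakk>x \<in> carrier_vec n; \<And>u. u \<in> set us \<Longrightarrow> u \<bullet> x = 0\<rbrakk>
      \<Longrightarrow> c * (x \<bullet> x) \<le> x \<bullet> (A *\<^sub>v x)"
  shows "n \<le> size {#a \<in># proots (char_poly A). c \<le> a#} + length us"
proof -
  obtain P D where PD: "P \<in> carrier_mat n n" "D \<in> carrier_mat n n" "diagonal_mat D"
      "P * P\<^sup>T = 1\<^sub>m n" "A = P * D * P\<^sup>T"
    using real_symmetric_diagonalization[OF A] by blast
  define S where "S = filter (\<lambda>i. c \<le> D $$ (i, i)) [0..<n]"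
  have PTP: "P\<^sup>T * P = 1\<^sub>m n" using PD mat_mult_left_right_inverse by (metis transpose_carrier_mat)
  have "similar_mat A D" using PD PTP by (intro similar_matI[of _ _ P "P\<^sup>T" n]) auto
  then have "char_poly A = (\<Prod>a\<leftarrow>diag_mat D. [:- a, 1:])"
    using char_poly_similar char_poly_upper_triangular[OF PD(2)] PD(2,3)
    by (metis carrier_matD diagonal_mat_def less_trans nat_neq_iff upper_triangularI)
  then have "size {#a \<in># proots (char_poly A). c \<le> a#} = length (filter (\<lambda>a. c \<le> a) (diag_mat D))"
    by (simp add: proots_prod_linear flip: mset_filter)
  also have "\<dots> = length S" using PD(2) by (simp add: diag_mat_def S_def filter_map comp_def)
  finally have size: "size {#a \<in># proots (char_poly A). c \<le> a#} = length S" .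
  show ?thesis
  proof (rule ccontr)
    \<comment> \<open>With too few eigenvalues at least \<open>c\<close>, their eigenvectors
      together with \<open>us\<close> number less than \<open>n\<close>. A nonzero \<open>x\<close>
      orthogonal to all of them has its form below \<open>c * (x \<bullet> x)\<close>, against
      \<open>form\<close>.\<close>
    assume "\<not> ?thesis"
    then have "length (us @ map (col P) S) < n" using size by simp
    moreover have "set (us @ map (col P) S) \<subseteq> carrier_vec n" using us PD(1) by (auto simp: S_def)
    ultimately obtain x where x: "x \<in> carrier_vec n" "x \<noteq> 0\<^sub>v n"
        "\<And>r. r \<in> set (us @ map (col P) S) \<Longrightarrow> r \<bullet> x = 0"
      using exists_orthogonal_vec by blast
    \<comment> \<open>The coordinates of \<open>x\<close> in the eigenbasis formed by the columns of
      \<open>P\<close>.\<close>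
    define y where "y = P\<^sup>T *\<^sub>v x"
    have y: "y \<in> carrier_vec n" using x PD by (simp add: y_def)
    have Py: "P *\<^sub>v y = x"
      using x(1) PD(1,4) assoc_mult_mat_vec[OF PD(1), of "P\<^sup>T" n x] by (simp add: y_def)
    have y0: "y $ i = 0" if "i < n" "c \<le> D $$ (i, i)" for i
      using that x(3)[of "col P i"] PD(1) by (auto simp: y_def S_def)
    have Dy: "(D *\<^sub>v y) $ i = D $$ (i, i) * y $ i" if i: "i < n" for i
    proof -
      have "(D *\<^sub>v y) $ i = (\<Sum>j = 0..<n. D $$ (i, j) * y $ j)"
        using i y PD(2) by (simp add: scalar_prod_def)
      also have "\<dots> = (\<Sum>j = 0..<n. if j = i then D $$ (i, i) * y $ i else 0)"
        using i PD(2,3) by (intro sum.cong) (auto simp: diagonal_mat_def)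
      finally show ?thesis using i by simp
    qed
    have "x \<bullet> (A *\<^sub>v x) = x \<bullet> (P *\<^sub>v (D *\<^sub>v y))"
      using PD(1,2) x(1)
      by (simp add: PD(5) y_def assoc_mult_mat_vec[of _ n n _ n] del: assoc_mult_mat)
    also have "\<dots> = y \<bullet> (D *\<^sub>v y)"
      using transpose_vec_mult_scalar[OF PD(1) _ x(1), of "D *\<^sub>v y"] y PD(2) by (simp add: y_def)
    also have "\<dots> = (\<Sum>i<n. D $$ (i, i) * (y $ i)\<^sup>2)"
      using Dy y PD(2) by (simp add: scalar_prod_def power2_eq_square atLeast0LessThan ac_simps)
    finally have xAx: "x \<bullet> (A *\<^sub>v x) = (\<Sum>i<n. D $$ (i, i) * (y $ i)\<^sup>2)" .
    have "x \<bullet> x = y \<bullet> y"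
      using transpose_vec_mult_scalar[OF PD(1) y x(1)] Py by (simp add: y_def)
    then have xx: "c * (x \<bullet> x) = (\<Sum>i<n. c * (y $ i)\<^sup>2)"
      using y by (simp add: real_scalar_prod_self sum_distrib_left)
    have "y \<noteq> 0\<^sub>v n" using Py x(2) PD(1) by auto
    then obtain i where i: "i < n" "y $ i \<noteq> 0"
      using y by (metis carrier_vecD eq_vecI index_zero_vec)
    \<comment> \<open>Strict, because a nonzero coordinate of \<open>y\<close> can only belong to an
      eigenvalue below \<open>c\<close>.\<close>
    have "(\<Sum>i<n. D $$ (i, i) * (y $ i)\<^sup>2) < (\<Sum>i<n. c * (y $ i)\<^sup>2)"
    proof (rule sum_strict_mono_ex1)
      show "\<forall>i\<in>{..<n}. D $$ (i, i) * (y $ i)\<^sup>2 \<le> c * (y $ i)\<^sup>2"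
        using y0 by (metis lessThan_iff linear mult_right_mono power_zero_numeral mult_zero_right order_refl zero_le_power2)
      have "D $$ (i, i) < c" using i y0 by force
      then show "\<exists>i\<in>{..<n}. D $$ (i, i) * (y $ i)\<^sup>2 < c * (y $ i)\<^sup>2"
        using i by (intro bexI[of _ i]) auto
    qed simp
    then show False using form[OF x(1)] x(3) xAx xx by simp
  qed
qed

text \<open>At an eigenvector \<open>x\<close> for \<open>a\<close> the form takes the value
  \<open>a * (x \<bullet> x)\<close>.\<close>

lemma root_char_poly_le:
  fixes A :: "real mat"
  assumes A: "A \<in> carrier_mat n n"
    and form: "\<And>x. x \<in> carrier_vec n \<Longrightarrow> x \<bullet> (A *\<^sub>v x) \<le> c * (x \<bullet> x)"
    and root: "poly (char_poly A) a = 0"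
  shows "a \<le> c"
proof -
  obtain x where x: "x \<in> carrier_vec n" "x \<noteq> 0\<^sub>v n" "A *\<^sub>v x = a \<cdot>\<^sub>v x"
    using root A eigenvalue_root_char_poly[OF A] unfolding eigenvalue_def eigenvector_def by auto
  then have "a * (x \<bullet> x) \<le> c * (x \<bullet> x)" using form[OF x(1)] by simp
  then show ?thesis using real_scalar_prod_self_pos[OF x(1,2)] by simp
qed

section \<open>The Laplacian and its quadratic form\<close>

context graph
begin

text \<open>\<open>out_degree\<close> counts arcs; without multiple arcs, \<open>head\<close> is
  injective on the arcs leaving \<open>v\<close>, so neighbours can be counted instead.\<close>

lemma out_degree_eq_card_dominated:
  "out_degree G v = card {w \<in> verts G. v \<rightarrow>\<^bsub>G\<^esub> w}"
proof -
  have "bij_betw (head G) (out_arcs G v) {w \<in> verts G. v \<rightarrow>\<^bsub>G\<^esub> w}"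
    unfolding bij_betw_def
  proof
    show "inj_on (head G) (out_arcs G v)"
      using no_multi_arcs by (auto simp: inj_on_def arc_to_ends_def)
    show "head G ` out_arcs G v = {w \<in> verts G. v \<rightarrow>\<^bsub>G\<^esub> w}"
      by (auto simp: arcs_ends_conv image_iff)
  qed
  then show ?thesis by (simp add: out_degree_def bij_betw_same_card)
qed

end

locale enumerated_graph = graph G for G :: "('a, 'b) pre_digraph" +
  fixes vs :: "'a list"
  assumes distinct_vs: "distinct vs" and set_vs: "set vs = verts G"
begin

abbreviation "n \<equiv> length vs"
abbreviation "L \<equiv> laplacian_mat G vs"

text \<open>A function on all of \<open>nat\<close> instead of a matrix entry, so that symmetry,
  range and zero diagonal hold without index bounds.\<close>

definition adj :: "nat \<Rightarrow> nat \<Rightarrow> real" where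
  "adj i j = (if vs ! i \<rightarrow>\<^bsub>G\<^esub> vs ! j then 1 else 0)"

lemma adj_range: "0 \<le> adj i j" "adj i j \<le> 1"
  by (auto simp: adj_def)

lemma adj_sym: "adj i j = adj j i"
  unfolding adj_def using arcs_ends_symmetric[OF sym_arcs] by metis

lemma adj_self: "adj i i = 0"
  unfolding adj_def using adj_not_same by metis

lemma out_degree_eq_card_index:
  assumes "i < n"
  shows "out_degree G (vs ! i) = card {j. j < n \<and> vs ! i \<rightarrow>\<^bsub>G\<^esub> vs ! j}"
proof -
  have "bij_betw (\<lambda>j. vs ! j) {j. j < n \<and> vs ! i \<rightarrow>\<^bsub>G\<^esub> vs ! j} {w \<in> verts G. vs ! i \<rightarrow>\<^bsub>G\<^esub> w}"
    using distinct_vs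
    by (auto simp: bij_betw_def inj_on_def nth_eq_iff_index_eq in_set_conv_nth simp flip: set_vs)
  then show ?thesis by (simp add: out_degree_eq_card_dominated bij_betw_same_card)
qed

lemma out_degree_eq_sum_adj:
  assumes "i < n"
  shows "real (out_degree G (vs ! i)) = (\<Sum>j<n. adj i j)"
proof -
  have "real (out_degree G (vs ! i)) = (\<Sum>j | j < n \<and> vs ! i \<rightarrow>\<^bsub>G\<^esub> vs ! j. 1)"
    by (simp add: out_degree_eq_card_index[OF assms])
  also have "\<dots> = (\<Sum>j<n. adj i j)" unfolding adj_def
    by (intro sum.mono_neutral_cong_left) auto
  finally show ?thesis .
qed

lemma laplacian_carrier: "L \<in> carrier_mat n n"
  by (rule carrier_matI) (simp_all add: laplacian_mat_def degree_mat_def adjacency_mat_def)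

lemma laplacian_index:
  assumes "i < n" "j < n"
  shows "L $$ (i, j) = (if i = j then (\<Sum>k<n. adj i k) else 0) - adj i j"
  using assms
  by (simp add: laplacian_mat_def degree_mat_def adjacency_mat_def out_degree_eq_sum_adj
      adj_def[of i j])

lemma laplacian_symmetric: "L\<^sup>T = L"
proof (rule eq_matI)
  fix i j
  assume "i < dim_row L" "j < dim_col L"
  then show "L\<^sup>T $$ (i, j) = L $$ (i, j)"
    using laplacian_carrier by (simp add: laplacian_index adj_sym[of j i])
qed (use laplacian_carrier in auto)

text \<open>The factor 2 arises because ordered pairs count every edge twice. Exchanging
  \<open>i\<close> and \<open>j\<close> and adding both versions turns the summand
  \<open>x $ i * (x $ i - x $ j)\<close> into a square.\<close>

lemma laplacian_form:
  assumes x: "x \<in> carrier_vec n"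
  shows "2 * (x \<bullet> (L *\<^sub>v x)) = (\<Sum>i<n. \<Sum>j<n. adj i j * (x $ i - x $ j)\<^sup>2)"
proof -
  have Lx: "(L *\<^sub>v x) $ i = (\<Sum>j<n. adj i j * (x $ i - x $ j))" if i: "i < n" for i
  proof -
    have "(L *\<^sub>v x) $ i = (\<Sum>j<n. L $$ (i, j) * x $ j)"
      using i x laplacian_carrier by (simp add: scalar_prod_def atLeast0LessThan)
    also have "\<dots> = (\<Sum>j<n. (if j = i then (\<Sum>k<n. adj i k) * x $ i else 0) - adj i j * x $ j)"
      using i by (intro sum.cong) (auto simp: laplacian_index algebra_simps)
    also have "\<dots> = (\<Sum>j<n. adj i j * (x $ i - x $ j))"
      using i by (simp add: sum_subtractf sum_distrib_right right_diff_distrib)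
    finally show ?thesis .
  qed
  have form: "x \<bullet> (L *\<^sub>v x) = (\<Sum>i<n. \<Sum>j<n. adj i j * (x $ i * (x $ i - x $ j)))"
    using x laplacian_carrier Lx
    by (simp add: scalar_prod_def atLeast0LessThan sum_distrib_left algebra_simps)
  also have "\<dots> = (\<Sum>j<n. \<Sum>i<n. adj i j * (x $ i * (x $ i - x $ j)))"
    by (rule sum.swap)
  also have "\<dots> = (\<Sum>i<n. \<Sum>j<n. adj i j * (x $ j * (x $ j - x $ i)))"
    using adj_sym by simp
  finally have "2 * (x \<bullet> (L *\<^sub>v x)) = (\<Sum>i<n. \<Sum>j<n. adj i j * (x $ i * (x $ i - x $ j)))
      + (\<Sum>i<n. \<Sum>j<n. adj i j * (x $ j * (x $ j - x $ i)))"
    using form by simp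
  then show ?thesis by (simp add: sum.distrib[symmetric] power2_eq_square algebra_simps)
qed

lemma laplacian_form_le:
  assumes x: "x \<in> carrier_vec n"
  shows "x \<bullet> (L *\<^sub>v x) \<le> real n * (x \<bullet> x)"
proof -
  have "2 * (x \<bullet> (L *\<^sub>v x)) \<le> (\<Sum>i<n. \<Sum>j<n. (x $ i - x $ j)\<^sup>2)"
    unfolding laplacian_form[OF x] using adj_range by (intro sum_mono mult_left_le_one_le) auto
  also have "\<dots> = (\<Sum>i<n. \<Sum>j<n. (x $ i)\<^sup>2 + (x $ j)\<^sup>2 - 2 * (x $ i * x $ j))"
    by (simp add: power2_diff mult.assoc)
  \<comment> \<open>Twice the form of the complete graph, which dominates that of \<open>G\<close>
    since \<open>adj\<close> is at most 1.\<close>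
  also have "\<dots> = 2 * real n * (x \<bullet> x) - 2 * (\<Sum>i<n. x $ i)\<^sup>2"
  proof -
    have "(\<Sum>i<n. \<Sum>j<n. x $ i * x $ j) = (\<Sum>i<n. x $ i)\<^sup>2"
      by (simp add: power2_eq_square sum_product)
    then show ?thesis
      using x by (simp add: real_scalar_prod_self sum.distrib sum_subtractf flip: sum_distrib_left)
  qed
  finally show ?thesis using zero_le_power2[of "\<Sum>i<n. x $ i"] by linarith
qed

section \<open>Eigenvalues at least 1 from a star\<close>

text \<open>Dropping the edges outside the star at \<open>v\<close> only decreases the form. By
  \<open>supp\<close> and \<open>sum0\<close> the leaf entries add up to \<open>- x $ v\<close>, so
  the cross term of the star form becomes \<open>2 * (x $ v)\<^sup>2\<close>, which is
  nonnegative.\<close>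

lemma laplacian_form_star_ge:
  assumes x: "x \<in> carrier_vec n" and v: "v < n"
    and supp: "\<And>j. \<lbrakk>j < n; j \<noteq> v; adj v j = 0\<rbrakk> \<Longrightarrow> x $ j = 0"
    and sum0: "(\<Sum>j<n. x $ j) = 0"
  shows "x \<bullet> x \<le> x \<bullet> (L *\<^sub>v x)"
proof -
  let ?star = "\<Sum>j<n. adj v j * (x $ v - x $ j)\<^sup>2"
  \<comment> \<open>Each star edge occurs in the double sum of \<open>laplacian_form\<close> once in
    row \<open>v\<close> and once in column \<open>v\<close>. The overlap at \<open>(v, v)\<close>
    contributes 0.\<close>
  have "2 * ?star = (\<Sum>i<n. (if i = v then ?star else 0) + adj i v * (x $ i - x $ v)\<^sup>2)"
    using v by (simp add: sum.distrib adj_sym[of _ v] power2_commute[of _ "x $ v"])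
  also have "\<dots> = (\<Sum>i<n. \<Sum>j<n. (if i = v then adj v j * (x $ v - x $ j)\<^sup>2 else 0)
      + (if j = v then adj i v * (x $ i - x $ v)\<^sup>2 else 0))"
    using v by (intro sum.cong) (auto simp: sum.distrib)
  also have "\<dots> \<le> 2 * (x \<bullet> (L *\<^sub>v x))"
    unfolding laplacian_form[OF x] using adj_range adj_self by (intro sum_mono) auto
  finally have "?star \<le> x \<bullet> (L *\<^sub>v x)" by simp
  have dec: "x $ j = (if j = v then x $ v else 0) + adj v j * x $ j" if "j < n" for j
    using supp[OF that] adj_self[of v] by (auto simp: adj_def)
  have "0 = (\<Sum>j<n. (if j = v then x $ v else 0) + adj v j * x $ j)"
    using dec sum0 by (metis (no_types, lifting) lessThan_iff sum.cong)
  then have leaves: "(\<Sum>j<n. adj v j * x $ j) = - x $ v"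
    using v by (simp add: sum.distrib)
  have "x \<bullet> x = (\<Sum>j<n. (if j = v then (x $ v)\<^sup>2 else 0) + adj v j * (x $ j)\<^sup>2)"
    using x supp adj_self[of v] unfolding real_scalar_prod_self
    by (intro sum.cong) (auto simp: adj_def)
  also have "\<dots> = (x $ v)\<^sup>2 + (\<Sum>j<n. adj v j * (x $ j)\<^sup>2)"
    using v by (simp add: sum.distrib)
  \<comment> \<open>The cross term alone already supplies the required
    \<open>(x $ v)\<^sup>2\<close>, whatever the degree of \<open>v\<close>.\<close>
  also have "\<dots> \<le> (\<Sum>j<n. adj v j) * (x $ v)\<^sup>2 - 2 * x $ v * (\<Sum>j<n. adj v j * x $ j)
      + (\<Sum>j<n. adj v j * (x $ j)\<^sup>2)"
    using adj_range unfolding leaves by (simp add: sum_nonneg power2_eq_square)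
  also have "\<dots> = ?star"
    by (simp add: sum_distrib_left sum_distrib_right power2_diff sum.distrib sum_subtractf algebra_simps)
  finally show ?thesis using \<open>?star \<le> _\<close> by simp
qed

lemma count_eigenvalues_ge_one:
  assumes v: "v \<in> verts G"
  shows "out_degree G v \<le> size {#a \<in># proots (char_poly L). 1 \<le> a#}"
proof -
  obtain i where i: "i < n" "v = vs ! i" using v set_vs by (metis in_set_conv_nth)
  define N where "N = {j. j < n \<and> vs ! i \<rightarrow>\<^bsub>G\<^esub> vs ! j}"
  have N: "out_degree G v = card N" using out_degree_eq_card_index i by (simp add: N_def)
  have iN: "i \<notin> N" using adj_self[of i] by (auto simp: N_def adj_def)
  define js where "js = filter (\<lambda>j. j \<notin> insert i N) [0..<n]"
  have "length js = card ({..<n} - insert i N)"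
    by (subst distinct_card[symmetric]) (auto simp: js_def intro: arg_cong[where f = card])
  also have "\<dots> = n - (card N + 1)"
    using i iN by (subst card_Diff_subset) (auto simp: N_def)
  finally have js: "length js = n - (card N + 1)" .
  \<comment> \<open>Ensures that the truncated subtraction in \<open>js\<close> is exact.\<close>
  have "card (insert i N) \<le> n" using i card_mono[of "{..<n}" "insert i N"] by (auto simp: N_def)
  then have cardN: "card N + 1 \<le> n" using iN by (simp add: N_def)
  \<comment> \<open>Orthogonality to the all-ones vector means entry sum 0, and the unit vectors
    enforce support on the closed neighbourhood of \<open>v\<close>. In total these are
    \<open>n - card N\<close> constraints, leaving \<open>out_degree G v\<close>
    eigenvalues.\<close>
  define us where "us = vec n (\<lambda>_. 1 :: real) # map (unit_vec n) js"
  have "n \<le> size {#a \<in># proots (char_poly L). 1 \<le> a#} + length us"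
  proof (rule count_eigenvalues_ge[OF laplacian_carrier laplacian_symmetric])
    show "set us \<subseteq> carrier_vec n" by (auto simp: us_def)
    fix x :: "real vec"
    assume x: "x \<in> carrier_vec n" and orth: "\<And>u. u \<in> set us \<Longrightarrow> u \<bullet> x = 0"
    have "(\<Sum>j<n. x $ j) = 0"
      using orth[of "vec n (\<lambda>_. 1)"] x by (simp add: us_def scalar_prod_def atLeast0LessThan)
    moreover have "x $ j = 0" if "j < n" "j \<noteq> i" "adj i j = 0" for j
      using orth[of "unit_vec n j"] that x by (auto simp: us_def js_def N_def adj_def split: if_splits)
    ultimately show "1 * (x \<bullet> x) \<le> x \<bullet> (L *\<^sub>v x)"
      using laplacian_form_star_ge[OF x i(1)] by simp
  qed
  then show ?thesis using N js cardN by (simp add: us_def)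
qed

end

theorem theorem8:
  fixes G :: "('a, 'b) pre_digraph" and vs :: "'a list"
  assumes "graph G"
    and "distinct vs" and "set vs = verts G"
  shows "laplacian_eigenvalue_count G vs {1..real (card (verts G))} \<ge> max_degree G"
proof -
  interpret graph G by fact
  interpret enumerated_graph G vs using assms by unfold_locales
  have card: "card (verts G) = n" using assms by (metis distinct_card)
  \<comment> \<open>Needed for the elements of \<open>proots\<close> to be exactly the roots. The
    upper bound on them then reduces membership in the interval to \<open>1 \<le> a\<close>.\<close>
  have "char_poly L \<noteq> 0" using degree_monic_char_poly[OF laplacian_carrier] by auto
  then have "a \<le> real n" if "a \<in># proots (char_poly L)" for a
    using that root_char_poly_le[OF laplacian_carrier laplacian_form_le] by simp
  then have "laplacian_eigenvalue_count G vs {1..real (card (verts G))}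
      = size {#a \<in># proots (char_poly L). 1 \<le> a#}"
    unfolding laplacian_eigenvalue_count_def card
    by (intro arg_cong[where f = size] filter_mset_cong) auto
  then show ?thesis
    using count_eigenvalues_ge_one unfolding max_degree_def by auto
qed

end
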